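(* Let $X$ be an order continuous Banach lattice with a weak unit, and let $L_1(\mu)$ be an AL-representation for $X$ (so $X$ is identified with an ideal of $L_1(\mu)$). For a sequence $(x_n)$ in $X$, we have that $(x_n)$ is un-convergent to $0$ in $X$ if and only if $(x_n)$ converges to $0$ in measure $\mu$ in $L_1(\mu)$.
   Context: A Banach lattice $X$ is order continuous if every net $x_\alpha\downarrow 0$ in $X$ satisfies $\|x_\alpha\|\to 0$. A vector $e\in X_+$ is a weak unit if the band generated by $e$ is $X$. A net $(x_\alpha)$ in $X$ is unbounded norm convergent (un-convergent) to $x$ if $\bigl\||x_\alpha-x|\wedge u\bigr\|\to 0$ for every $u\in X_+$. AL-representation: if $X$ is an order continuous Banach lattice with a weak unit $e$, it is known that there are a finite measure $\mu$ and a continuous vector lattice isomorphism $T\colon X\to L_1(\mu)$ onto its range such that $\operatorname{Range} T$ is an order and norm dense ideal of $L_1(\mu)$, $Te=\mathbb{1}$ (the constant one function), and $\operatorname{Range} T$ contains $L_\infty(\mu)$ as a norm and order dense ideal ($T$ need not be a norm isomorphism). One identifies $X$ with $\operatorname{Range}T$, views $X$ as an ideal of $L_1(\mu)$, and identifies $e$ with $\mathbb{1}$; such an inclusion of $X$ into $L_1(\mu)$ is called an AL-representation of $X$. *)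

theory Defs
  imports "HOL-Analysis.Analysis" "HOL-Library.Lattice_Algebras"
begin

section \<open>Banach lattices\<close>

text \<open>Real Banach lattices. The class \<^class>\<open>lattice_ab_group_add_abs\<close> contributes
  \<open>\<bar>x\<bar> = sup x (- x)\<close>, and the axiom below says that the norm is a lattice norm.\<close>

class banach_lattice = banach + ordered_real_vector + lattice_ab_group_add_abs +
  assumes norm_lattice_mono: "\<bar>x\<bar> \<le> \<bar>y\<bar> \<Longrightarrow> norm x \<le> norm y"

text \<open>A net is a function on a nonempty set \<open>I\<close> that is directed by a preorder \<open>r\<close>. The filter
  \<open>net_filter I r\<close> is generated by the tails of \<open>I\<close>, so that
  \<open>(f \<longlongrightarrow> l) (net_filter I r)\<close> is convergence of the net \<open>f\<close> to \<open>l\<close>.\<close>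

definition directed_set :: "'i set \<Rightarrow> ('i \<Rightarrow> 'i \<Rightarrow> bool) \<Rightarrow> bool" where
  "directed_set I r \<longleftrightarrow> I \<noteq> {} \<and> (\<forall>i\<in>I. r i i)
     \<and> (\<forall>i\<in>I. \<forall>j\<in>I. \<forall>k\<in>I. r i j \<longrightarrow> r j k \<longrightarrow> r i k)
     \<and> (\<forall>i\<in>I. \<forall>j\<in>I. \<exists>k\<in>I. r i k \<and> r j k)"

definition net_filter :: "'i set \<Rightarrow> ('i \<Rightarrow> 'i \<Rightarrow> bool) \<Rightarrow> 'i filter" where
  "net_filter I r = (INF i\<in>I. principal {j \<in> I. r i j})"

definition (in order) net_decreases_to ::
  "'i set \<Rightarrow> ('i \<Rightarrow> 'i \<Rightarrow> bool) \<Rightarrow> ('i \<Rightarrow> 'a) \<Rightarrow> 'a \<Rightarrow> bool" where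
  "net_decreases_to I r x a \<longleftrightarrow> (\<forall>i\<in>I. \<forall>j\<in>I. r i j \<longrightarrow> x j \<le> x i)
     \<and> (\<forall>i\<in>I. a \<le> x i) \<and> (\<forall>b. (\<forall>i\<in>I. b \<le> x i) \<longrightarrow> b \<le> a)"

text \<open>Order continuity of the norm. A class axiom cannot quantify over the type of indices, and
  index sets in the type of the space itself suffice: the range of a decreasing net, directed by
  the reversed order and indexed by itself, is a net with the same infimum, and the norms of one
  tend to \<open>0\<close> if and only if those of the other do.\<close>

class order_continuous_banach_lattice = banach_lattice +
  assumes order_continuous:
    "directed_set (I :: 'a set) r \<Longrightarrow> net_decreases_to I r (x :: 'a \<Rightarrow> 'a) 0
       \<Longrightarrow> ((\<lambda>i. norm (x i)) \<longlongrightarrow> 0) (net_filter I r)"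

definition lattice_ideal :: "'a::banach_lattice set \<Rightarrow> bool" where
  "lattice_ideal B \<longleftrightarrow> subspace B \<and> (\<forall>x y. y \<in> B \<longrightarrow> \<bar>x\<bar> \<le> \<bar>y\<bar> \<longrightarrow> x \<in> B)"

text \<open>A band is an ideal containing the supremum of each of its subsets that has one in the
  whole space.\<close>

definition band :: "'a::banach_lattice set \<Rightarrow> bool" where
  "band B \<longleftrightarrow> lattice_ideal B
     \<and> (\<forall>D s. D \<subseteq> B \<longrightarrow> D \<noteq> {} \<longrightarrow> (\<forall>d\<in>D. d \<le> s)
          \<longrightarrow> (\<forall>b. (\<forall>d\<in>D. d \<le> b) \<longrightarrow> s \<le> b) \<longrightarrow> s \<in> B)"

definition band_generated :: "'a::banach_lattice \<Rightarrow> 'a set" where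
  "band_generated e = \<Inter>{B. band B \<and> e \<in> B}"

definition weak_unit :: "'a::banach_lattice \<Rightarrow> bool" where
  "weak_unit e \<longleftrightarrow> 0 \<le> e \<and> band_generated e = UNIV"

definition un_convergent :: "('i \<Rightarrow> 'a::banach_lattice) \<Rightarrow> 'a \<Rightarrow> 'i filter \<Rightarrow> bool" where
  "un_convergent x a F \<longleftrightarrow> (\<forall>u\<ge>0. ((\<lambda>i. norm (inf \<bar>x i - a\<bar> u)) \<longlongrightarrow> 0) F)"


section \<open>Function spaces\<close>

text \<open>Elements of \<open>L\<^sub>1(M)\<close> and \<open>L\<^sub>\<infinity>(M)\<close> are represented by functions; equality and order are
  understood almost everywhere. Subsets of \<open>L\<^sub>1(M)\<close> are represented by sets of functions that are
  closed under almost everywhere equality among measurable functions.\<close>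

definition L1 :: "'b measure \<Rightarrow> ('b \<Rightarrow> real) set" where
  "L1 M = {f. integrable M f}"

definition Linf :: "'b measure \<Rightarrow> ('b \<Rightarrow> real) set" where
  "Linf M = {f \<in> borel_measurable M. \<exists>C. AE s in M. \<bar>f s\<bar> \<le> C}"

text \<open>\<open>F\<close> is an ideal (solid vector subspace) of \<open>G\<close>.\<close>

definition ideal_in ::
  "'b measure \<Rightarrow> ('b \<Rightarrow> real) set \<Rightarrow> ('b \<Rightarrow> real) set \<Rightarrow> bool" where
  "ideal_in M F G \<longleftrightarrow> F \<subseteq> G \<and> (\<lambda>_. 0) \<in> F
     \<and> (\<forall>f\<in>F. \<forall>g\<in>F. (\<lambda>s. f s + g s) \<in> F)
     \<and> (\<forall>c. \<forall>f\<in>F. (\<lambda>s. c * f s) \<in> F)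
     \<and> (\<forall>f\<in>F. \<forall>g\<in>G. (AE s in M. \<bar>g s\<bar> \<le> \<bar>f s\<bar>) \<longrightarrow> g \<in> F)"

text \<open>Below every \<open>0 < g\<close> in \<open>G\<close> there is some \<open>f\<close> in \<open>F\<close> with \<open>0 < f \<le> g\<close>.\<close>

definition order_dense_in ::
  "'b measure \<Rightarrow> ('b \<Rightarrow> real) set \<Rightarrow> ('b \<Rightarrow> real) set \<Rightarrow> bool" where
  "order_dense_in M F G \<longleftrightarrow>
     (\<forall>g\<in>G. (AE s in M. 0 \<le> g s) \<longrightarrow> \<not> (AE s in M. g s = 0) \<longrightarrow>
        (\<exists>f\<in>F. (AE s in M. 0 \<le> f s) \<and> \<not> (AE s in M. f s = 0) \<and> (AE s in M. f s \<le> g s)))"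

definition L1_norm_dense :: "'b measure \<Rightarrow> ('b \<Rightarrow> real) set \<Rightarrow> bool" where
  "L1_norm_dense M F \<longleftrightarrow> (\<forall>g\<in>L1 M. \<forall>\<epsilon>>0. \<exists>f\<in>F. (LINT s|M. \<bar>f s - g s\<bar>) < \<epsilon>)"

definition range_AE :: "'b measure \<Rightarrow> ('a \<Rightarrow> 'b \<Rightarrow> real) \<Rightarrow> ('b \<Rightarrow> real) set" where
  "range_AE M T = {f \<in> borel_measurable M. \<exists>x. AE s in M. T x s = f s}"

definition converges_in_measure ::
  "'b measure \<Rightarrow> ('i \<Rightarrow> 'b \<Rightarrow> real) \<Rightarrow> ('b \<Rightarrow> real) \<Rightarrow> 'i filter \<Rightarrow> bool" where
  "converges_in_measure M f g F \<longleftrightarrow>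
     (\<forall>\<epsilon>>0. ((\<lambda>i. measure M {s \<in> space M. \<bar>f i s - g s\<bar> > \<epsilon>}) \<longlongrightarrow> 0) F)"


section \<open>AL-representations\<close>

text \<open>\<open>T\<close> is the inclusion of \<open>X = 'a\<close> into \<open>L\<^sub>1(M)\<close> as an ideal. As \<open>X\<close> is identified with the
  range of \<open>T\<close>, norm density of \<open>L\<^sub>\<infinity>(M)\<close> in the range is density for the norm of \<open>X\<close>.\<close>

locale AL_representation = finite_measure M
  for M :: "'b measure" +
  fixes T :: "'a::banach_lattice \<Rightarrow> 'b \<Rightarrow> real" and e :: 'a
  assumes in_L1: "T x \<in> L1 M"
    and add: "AE s in M. T (x + y) s = T x s + T y s"
    and scale: "AE s in M. T (c *\<^sub>R x) s = c * T x s"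
    and sup: "AE s in M. T (sup x y) s = max (T x s) (T y s)"
    and inf: "AE s in M. T (inf x y) s = min (T x s) (T y s)"
    and inj: "(AE s in M. T x s = T y s) \<Longrightarrow> x = y"
    and cont: "((\<lambda>y. LINT s|M. \<bar>T y s - T x s\<bar>) \<longlongrightarrow> 0) (at x)"
    and unit: "AE s in M. T e s = 1"
    and range_ideal: "ideal_in M (range_AE M T) (L1 M)"
    and range_order_dense: "order_dense_in M (range_AE M T) (L1 M)"
    and range_norm_dense: "L1_norm_dense M (range_AE M T)"
    and Linf_ideal: "ideal_in M (Linf M) (range_AE M T)"
    and Linf_order_dense: "order_dense_in M (Linf M) (range_AE M T)"
    and Linf_norm_dense: "\<epsilon> > 0 \<Longrightarrow> \<exists>y. T y \<in> Linf M \<and> norm (x - y) < \<epsilon>"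

end

theory Submission
  imports Defs
begin

text \<open>Everything rests on comparing the two modes of convergence through the truncations
  \<open>inf \<bar>x\<^sub>n\<bar> u\<close>.

  If \<open>x\<close> is un-convergent to \<open>0\<close>, take \<open>u = e\<close>. Since \<open>T e = 1\<close>, continuity of the inclusion into
  \<open>L\<^sub>1\<close> turns \<open>norm (inf \<bar>x\<^sub>n\<bar> e) \<longlonglongrightarrow> 0\<close> into \<open>\<integral> min \<bar>T x\<^sub>n\<bar> 1 \<longlonglongrightarrow> 0\<close>, and Markov's
  inequality gives convergence in measure.

  Conversely, convergence in measure implies almost everywhere convergence of a subsequence, and
  it suffices to find in each subsequence of \<open>norm (inf \<bar>x\<^sub>n\<bar> u)\<close> a further one tending to \<open>0\<close>. So
  let \<open>T y\<^sub>n \<longlonglongrightarrow> 0\<close> almost everywhere. The tail suprema of \<open>min \<bar>T y\<^sub>n\<bar> \<bar>T u\<bar>\<close> are dominated by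
  \<open>\<bar>T u\<bar>\<close>; because the range of \<open>T\<close> is an ideal of \<open>L\<^sub>1\<close> they come from vectors \<open>w\<^sub>k\<close>, which
  dominate \<open>inf \<bar>y\<^sub>n\<bar> u\<close> for \<open>n \<ge> k\<close>. The functions decrease to \<open>0\<close> almost everywhere, and \<open>T\<close>
  reflects the order, so \<open>w\<^sub>k\<close> decreases to \<open>0\<close> in \<open>X\<close>, and order continuity of the norm
  gives \<open>norm w\<^sub>k \<longlonglongrightarrow> 0\<close>.\<close>

section \<open>Order continuity along sequences\<close>

text \<open>The range of the sequence, indexed by itself and directed by the reversed order, is a net to
  which the defining axiom of order continuity applies.\<close>

lemma order_continuous_decseq:
  fixes w :: "nat \<Rightarrow> 'a::order_continuous_banach_lattice"
  assumes "decseq w" and nonneg: "\<And>k. 0 \<le> w k"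
    and greatest: "\<And>b. (\<And>k. b \<le> w k) \<Longrightarrow> b \<le> 0"
  shows "(\<lambda>k. norm (w k)) \<longlonglongrightarrow> 0"
proof (rule LIMSEQ_I)
  fix \<epsilon> :: real assume "\<epsilon> > 0"
  let ?r = "\<lambda>a b :: 'a. b \<le> a"
  have common_bound: "\<exists>k\<in>range w. k \<le> a \<and> k \<le> b" if "a \<in> range w" "b \<in> range w" for a b
  proof -
    obtain i j where "a = w i" "b = w j" using \<open>a \<in> range w\<close> \<open>b \<in> range w\<close> by blast
    then have "w (max i j) \<le> a \<and> w (max i j) \<le> b"
      using \<open>decseq w\<close> by (simp add: decseq_def)
    then show ?thesis by blast
  qed
  then have "directed_set (range w) ?r"
    unfolding directed_set_def by (blast intro: order_trans)
  moreover have "net_decreases_to (range w) ?r (\<lambda>a. a) 0"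
    unfolding net_decreases_to_def using nonneg greatest by auto
  ultimately have "(norm \<longlongrightarrow> 0) (net_filter (range w) ?r)"
    by (rule order_continuous)
  then have "eventually (\<lambda>a. norm a < \<epsilon>) (net_filter (range w) ?r)"
    using \<open>\<epsilon> > 0\<close> by (auto dest: order_tendstoD(2))
  then obtain a where "a \<in> range w" and a: "\<And>b. b \<in> range w \<Longrightarrow> b \<le> a \<Longrightarrow> norm b < \<epsilon>"
    unfolding net_filter_def
    by (subst (asm) eventually_INF_base)
       (use common_bound in \<open>auto simp: eventually_principal intro: order_trans; blast intro: order_trans\<close>)+
  then obtain k where "a = w k" by blast
  then have "norm (norm (w n) - 0) < \<epsilon>" if "n \<ge> k" for n
    using a[of "w n"] \<open>decseq w\<close> that by (simp add: decseq_def)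
  then show "\<exists>k. \<forall>n\<ge>k. norm (norm (w n) - 0) < \<epsilon>" by blast
qed

section \<open>Lattice structure and range of the representation\<close>

context AL_representation
begin

lemma integrable_T: "integrable M (T x)"
  using in_L1 by (simp add: L1_def)

lemma T_zero: "AE s in M. T 0 s = 0"
  using scale[of 0 0] by simp

lemma T_abs: "AE s in M. T \<bar>x\<bar> s = \<bar>T x s\<bar>"
proof -
  have "AE s in M. T (- x) s = - T x s"
    using scale[of "-1" x] by simp
  with sup[of x "- x"] show ?thesis
    by eventually_elim (auto simp: abs_lattice[of x])
qed

text \<open>The order is determined by the lattice operations, which \<open>T\<close> preserves, and by equality,
  which \<open>T\<close> reflects by injectivity.\<close>

lemma T_le_iff: "(AE s in M. T x s \<le> T y s) \<longleftrightarrow> x \<le> y"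
proof
  assume "AE s in M. T x s \<le> T y s"
  with inf[of x y] have "AE s in M. T (inf x y) s = T x s"
    by eventually_elim simp
  then show "x \<le> y"
    using inj by (metis inf.absorb_iff1)
next
  assume "x \<le> y"
  then have "inf x y = x" by (rule inf_absorb1)
  with inf[of x y] show "AE s in M. T x s \<le> T y s"
    by (simp add: min_def) (metis (mono_tags, lifting) AE_mp AE_I2 linear)
qed

lemma T_truncation:
  assumes "0 \<le> u"
  shows "AE s in M. T (inf \<bar>x\<bar> u) s = min \<bar>T x s\<bar> \<bar>T u s\<bar>"
proof -
  have "AE s in M. T 0 s \<le> T u s" using assms T_le_iff by blast
  with inf[of "\<bar>x\<bar>" u] T_abs[of x] T_zero show ?thesis
    by eventually_elim simp
qed

lemma T_surj_dominated:
  assumes "f \<in> borel_measurable M" and "AE s in M. \<bar>f s\<bar> \<le> \<bar>T u s\<bar>"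
  obtains y where "AE s in M. T y s = f s"
proof -
  have "f \<in> L1 M"
    unfolding L1_def
    using Bochner_Integration.integrable_bound[OF integrable_T[of u] assms(1)] assms(2) by simp
  moreover have "T u \<in> range_AE M T"
    unfolding range_AE_def using integrable_T[of u] by auto
  ultimately have "f \<in> range_AE M T"
    using range_ideal assms(2) unfolding ideal_in_def by blast
  then show thesis using that unfolding range_AE_def by blast
qed

end

section \<open>From almost everywhere convergence to un-convergence\<close>

text \<open>The vectors representing the tail suprema of the truncations decrease to \<open>0\<close>, which is
  where order continuity enters.\<close>

lemma AE_null_imp_truncations_null:
  fixes T :: "'a::order_continuous_banach_lattice \<Rightarrow> 'b \<Rightarrow> real"
  assumes "AL_representation M T e"
    and null: "AE s in M. (\<lambda>n. T (y n) s) \<longlonglongrightarrow> 0"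
    and "0 \<le> u"
  shows "(\<lambda>n. norm (inf \<bar>y n\<bar> u)) \<longlonglongrightarrow> 0"
proof -
  interpret AL_representation M T e by fact
  define g where "g n s = min \<bar>T (y n) s\<bar> \<bar>T u s\<bar>" for n s
  define F where "F k s = (SUP n\<in>{k..}. g n s)" for k s
  have g_bound: "0 \<le> g n s" "g n s \<le> \<bar>T u s\<bar>" for n s
    by (auto simp: g_def)
  have bdd: "bdd_above ((\<lambda>n. g n s) ` A)" for s A
    using g_bound(2) by (auto intro!: bdd_aboveI)
  have g_le_F: "g n s \<le> F k s" if "k \<le> n" for n k s
    unfolding F_def using that bdd by (auto intro!: cSUP_upper)
  have F_nonneg: "0 \<le> F k s" for k s
    using g_bound(1)[of k s] g_le_F[of k k s] by simp
  have F_bound: "F k s \<le> \<bar>T u s\<bar>" for k s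
    unfolding F_def using g_bound(2) by (auto intro!: cSUP_least)
  have F_Suc: "F (Suc k) s \<le> F k s" for k s
    unfolding F_def using bdd by (intro cSUP_subset_mono) auto
  have [measurable]: "T z \<in> borel_measurable M" for z
    using integrable_T[of z] by auto
  have F_measurable: "F k \<in> borel_measurable M" for k
    unfolding F_def
    by (rule borel_measurable_cSUP[OF _ _ bdd]) (auto simp: g_def)
  have "\<exists>w. AE s in M. T w s = F k s" for k
  proof -
    have "AE s in M. \<bar>F k s\<bar> \<le> \<bar>T u s\<bar>" using F_nonneg F_bound by simp
    from T_surj_dominated[OF F_measurable this] show ?thesis by blast
  qed
  then obtain w where w: "\<And>k. AE s in M. T (w k) s = F k s" by metis
  have "decseq w"
  proof (rule decseq_SucI, subst T_le_iff[symmetric])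
    fix k show "AE s in M. T (w (Suc k)) s \<le> T (w k) s"
      using w[of k] w[of "Suc k"] by eventually_elim (simp add: F_Suc)
  qed
  moreover have w_nonneg: "0 \<le> w k" for k
  proof (subst T_le_iff[symmetric])
    show "AE s in M. T 0 s \<le> T (w k) s"
      using w[of k] T_zero by eventually_elim (simp add: F_nonneg)
  qed
  moreover have "b \<le> 0" if b: "\<And>k. b \<le> w k" for b
  proof (subst T_le_iff[symmetric])
    have "AE s in M. \<forall>k. T b s \<le> T (w k) s"
      using b T_le_iff by (auto simp: AE_all_countable)
    moreover have "AE s in M. \<forall>k. T (w k) s = F k s"
      using w by (auto simp: AE_all_countable)
    ultimately show "AE s in M. T b s \<le> T 0 s"
      using null T_zero
    proof eventually_elim
      case (elim s)
      have "T b s \<le> 0 + \<epsilon>" if "\<epsilon> > 0" for \<epsilon>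
      proof -
        obtain k where k: "\<And>n. n \<ge> k \<Longrightarrow> \<bar>T (y n) s\<bar> < \<epsilon>"
          using LIMSEQ_D[OF elim(3) \<open>\<epsilon> > 0\<close>] by auto
        have "F k s \<le> \<epsilon>"
          unfolding F_def using k by (intro cSUP_least) (auto simp: g_def min_le_iff_disj less_imp_le)
        then show ?thesis using elim by (metis add_0 order_trans)
      qed
      then show ?case using elim(4) by (metis field_le_epsilon)
    qed
  qed
  ultimately have w_null: "(\<lambda>k. norm (w k)) \<longlonglongrightarrow> 0"
    by (rule order_continuous_decseq)
  have w_dominates: "norm (inf \<bar>y n\<bar> u) \<le> norm (w n)" for n
  proof (rule norm_lattice_mono)
    have "AE s in M. T (inf \<bar>y n\<bar> u) s \<le> T (w n) s"
      using w[of n] T_truncation[OF \<open>0 \<le> u\<close>, of "y n"]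
      by eventually_elim (use g_le_F in \<open>auto simp: g_def\<close>)
    then have "inf \<bar>y n\<bar> u \<le> w n" by (simp only: T_le_iff)
    moreover have "0 \<le> inf \<bar>y n\<bar> u" using \<open>0 \<le> u\<close> by simp
    ultimately show "\<bar>inf \<bar>y n\<bar> u\<bar> \<le> \<bar>w n\<bar>" using w_nonneg by simp
  qed
  show ?thesis
    by (rule Lim_null_comparison[OF _ w_null]) (simp add: w_dominates)
qed

section \<open>Convergence in measure\<close>

text \<open>Splitting the space at \<open>\<bar>f\<bar> > \<epsilon>\<close> bounds the integral of \<open>min \<bar>f\<bar> 1\<close> by the measure of that
  set plus \<open>\<epsilon> \<mu>(\<Omega>)\<close>, and Markov's inequality bounds the measure by the integral. Hence convergence
  in measure to \<open>0\<close> on a finite measure space is \<open>L\<^sub>1\<close> convergence of these truncations.\<close>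

lemma (in finite_measure) converges_in_measure_zero_iff:
  assumes [measurable]: "\<And>n. f n \<in> borel_measurable M"
  shows "converges_in_measure M f (\<lambda>_. 0) F
           \<longleftrightarrow> ((\<lambda>n. LINT s|M. min \<bar>f n s\<bar> 1) \<longlongrightarrow> 0) F"
proof -
  let ?h = "\<lambda>n s. min \<bar>f n s\<bar> 1"
  let ?A = "\<lambda>\<epsilon> n. {s \<in> space M. \<bar>f n s - 0\<bar> > \<epsilon>}"
  have int: "integrable M (?h n)" for n
    by (rule integrable_const_bound[where B = 1]) auto
  show ?thesis
  proof
    assume conv: "converges_in_measure M f (\<lambda>_. 0) F"
    show "((\<lambda>n. LINT s|M. ?h n s) \<longlongrightarrow> 0) F"
    proof (rule tendstoI)
      fix \<epsilon> :: real assume "\<epsilon> > 0"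
      define m where "m = measure M (space M)"
      define \<delta> where "\<delta> = \<epsilon> / (2 * (m + 1))"
      have "m \<ge> 0" by (simp add: m_def)
      then have "\<delta> > 0" and \<delta>: "\<delta> * m \<le> \<epsilon> / 2"
        using \<open>\<epsilon> > 0\<close> by (auto simp: \<delta>_def field_simps)
      have le: "(LINT s|M. ?h n s) \<le> \<delta> * m + measure M (?A \<delta> n)" for n
      proof -
        have "(LINT s|M. ?h n s) \<le> (LINT s|M. \<delta> + indicator (?A \<delta> n) s)"
          by (intro integral_mono int Bochner_Integration.integrable_add integrable_const
                integrable_real_indicator)
             (use \<open>\<delta> > 0\<close> in \<open>auto simp: indicator_def min_def emeasure_eq_measure\<close>)
        also have "\<dots> = \<delta> * m + measure M (?A \<delta> n)"
          by (subst Bochner_Integration.integral_add) (auto simp: m_def emeasure_eq_measure)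
        finally show ?thesis .
      qed
      have "((\<lambda>n. measure M (?A \<delta> n)) \<longlongrightarrow> 0) F"
        using conv \<open>\<delta> > 0\<close> unfolding converges_in_measure_def by blast
      then have "eventually (\<lambda>n. measure M (?A \<delta> n) < \<epsilon> / 2) F"
        by (rule order_tendstoD(2)) (use \<open>\<epsilon> > 0\<close> in simp)
      then show "eventually (\<lambda>n. dist (LINT s|M. ?h n s) 0 < \<epsilon>) F"
      proof eventually_elim
        case (elim n)
        have "0 \<le> (LINT s|M. ?h n s)" by (intro integral_nonneg_AE) auto
        then show ?case using elim le[of n] \<delta> by simp
      qed
    qed
  next
    assume L1: "((\<lambda>n. LINT s|M. ?h n s) \<longlongrightarrow> 0) F"
    show "converges_in_measure M f (\<lambda>_. 0) F"
      unfolding converges_in_measure_def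
    proof (intro allI impI)
      fix \<epsilon> :: real assume "\<epsilon> > 0"
      \<comment> \<open>The truncation at \<open>1\<close> forces a threshold of at most \<open>1\<close>.\<close>
      define c where "c = min \<epsilon> 1"
      have "c > 0" using \<open>\<epsilon> > 0\<close> by (simp add: c_def)
      have le: "measure M (?A \<epsilon> n) \<le> (LINT s|M. ?h n s) / c" for n
      proof -
        have "measure M (?A \<epsilon> n) \<le> measure M {s \<in> space M. c \<le> ?h n s}"
          by (intro finite_measure_mono) (auto simp: c_def)
        also have "\<dots> \<le> (LINT s|M. ?h n s) / c"
          by (intro integral_Markov_inequality_measure[where A = "{}"] int)
             (use \<open>c > 0\<close> in auto)
        finally show ?thesis .
      qed
      have "((\<lambda>n. (LINT s|M. ?h n s) / c) \<longlongrightarrow> 0) F"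
        using tendsto_divide[OF L1 tendsto_const[of c]] \<open>c > 0\<close> by simp
      then show "((\<lambda>n. measure M (?A \<epsilon> n)) \<longlongrightarrow> 0) F"
        by (rule tendsto_sandwich[OF _ _ tendsto_const, rotated 2])
           (intro always_eventually allI measure_nonneg le)+
    qed
  qed
qed

lemma (in AL_representation) LINT_T_tendsto_zero:
  assumes "((\<lambda>i. norm (z i)) \<longlongrightarrow> 0) F"
  shows "((\<lambda>i. LINT s|M. \<bar>T (z i) s\<bar>) \<longlongrightarrow> 0) F"
proof -
  have at0: "(LINT s|M. \<bar>T y s - T 0 s\<bar>) = (LINT s|M. \<bar>T y s\<bar>)" for y
    using integrable_T T_zero by (intro integral_cong_AE) auto
  have "(LINT s|M. \<bar>T 0 s\<bar>) = 0" using at0[of 0] by simp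
  then have "isCont (\<lambda>y. LINT s|M. \<bar>T y s\<bar>) 0"
    using cont[of 0] by (simp add: isCont_def at0)
  moreover have "(z \<longlongrightarrow> 0) F"
    using assms by (rule tendsto_norm_zero_cancel)
  ultimately show ?thesis
    using isCont_tendsto_compose[of 0 "\<lambda>y. LINT s|M. \<bar>T y s\<bar>" z F]
    by (simp add: \<open>(LINT s|M. \<bar>T 0 s\<bar>) = 0\<close>)
qed

section \<open>Un-convergence and convergence in measure\<close>

theorem theorem4p6:
  fixes M :: "'b measure"
    and T :: "'a::order_continuous_banach_lattice \<Rightarrow> 'b \<Rightarrow> real"
    and e :: 'a
    and x :: "nat \<Rightarrow> 'a"
  assumes "weak_unit e"
    and "AL_representation M T e"
  shows "un_convergent x 0 sequentially
           \<longleftrightarrow> converges_in_measure M (\<lambda>n. T (x n)) (\<lambda>_. 0) sequentially"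
proof -
  interpret AL_representation M T e by fact
  have [measurable]: "T z \<in> borel_measurable M" for z
    using integrable_T[of z] by auto
  let ?h = "\<lambda>n s. min \<bar>T (x n) s\<bar> 1"
  have in_measure_iff: "converges_in_measure M (\<lambda>n. T (x n)) (\<lambda>_. 0) sequentially
      \<longleftrightarrow> (\<lambda>n. LINT s|M. ?h n s) \<longlonglongrightarrow> 0"
    by (rule converges_in_measure_zero_iff) simp
  have "(\<lambda>n. LINT s|M. ?h n s) \<longlonglongrightarrow> 0" if un: "un_convergent x 0 sequentially"
  proof -
    have "0 \<le> e" using \<open>weak_unit e\<close> by (simp add: weak_unit_def)
    with un have "(\<lambda>n. norm (inf \<bar>x n\<bar> e)) \<longlonglongrightarrow> 0"
      by (simp add: un_convergent_def)
    then have "(\<lambda>n. LINT s|M. \<bar>T (inf \<bar>x n\<bar> e) s\<bar>) \<longlonglongrightarrow> 0"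
      by (rule LINT_T_tendsto_zero)
    moreover have "(LINT s|M. \<bar>T (inf \<bar>x n\<bar> e) s\<bar>) = (LINT s|M. ?h n s)" for n
    proof (intro integral_cong_AE)
      show "AE s in M. \<bar>T (inf \<bar>x n\<bar> e) s\<bar> = ?h n s"
        using T_truncation[OF \<open>0 \<le> e\<close>, of "x n"] unit by eventually_elim simp
    qed auto
    ultimately show ?thesis by simp
  qed
  moreover have "un_convergent x 0 sequentially" if L1: "(\<lambda>n. LINT s|M. ?h n s) \<longlonglongrightarrow> 0"
    unfolding un_convergent_def
  proof (intro allI impI)
    fix u :: 'a assume "0 \<le> u"
    have "(\<lambda>n. norm (inf \<bar>x n\<bar> u)) \<longlonglongrightarrow> 0"
    proof (rule ccontr)
      assume "\<not> ?thesis"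
      then obtain \<epsilon> where "\<epsilon> > 0" and "\<And>N. \<exists>n\<ge>N. \<epsilon> \<le> norm (inf \<bar>x n\<bar> u)"
        by (auto simp: LIMSEQ_iff not_less)
      then have "infinite {n. \<epsilon> \<le> norm (inf \<bar>x n\<bar> u)}"
        by (auto simp: infinite_nat_iff_unbounded_le)
      then obtain q :: "nat \<Rightarrow> nat" where "strict_mono q"
        and q: "\<And>n. \<epsilon> \<le> norm (inf \<bar>x (q n)\<bar> u)"
        using infinite_enumerate by blast
      have "(\<lambda>n. LINT s|M. norm (?h (q n) s)) \<longlonglongrightarrow> 0"
        using LIMSEQ_subseq_LIMSEQ[OF L1 \<open>strict_mono q\<close>] by (simp add: o_def)
      moreover have "integrable M (?h (q n))" for n
        by (rule integrable_const_bound[where B = 1]) auto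
      ultimately obtain r :: "nat \<Rightarrow> nat" where
        r: "AE s in M. (\<lambda>n. ?h (q (r n)) s) \<longlonglongrightarrow> 0"
        using tendsto_L1_AE_subseq[of M "\<lambda>n. ?h (q n)"] by blast
      have "AE s in M. (\<lambda>n. T (x (q (r n))) s) \<longlonglongrightarrow> 0"
        using r
      proof eventually_elim
        case (elim s)
        \<comment> \<open>A truncation less than \<open>1\<close> equals the truncated value.\<close>
        have "eventually (\<lambda>n. ?h (q (r n)) s < 1) sequentially"
          using elim by (rule order_tendstoD(2)) simp
        then have "eventually (\<lambda>n. ?h (q (r n)) s = \<bar>T (x (q (r n))) s\<bar>) sequentially"
          by eventually_elim simp
        with elim have "(\<lambda>n. \<bar>T (x (q (r n))) s\<bar>) \<longlonglongrightarrow> 0"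
          by (rule Lim_transform_eventually)
        then show ?case by (simp add: tendsto_rabs_zero_iff)
      qed
      then have "(\<lambda>n. norm (inf \<bar>x (q (r n))\<bar> u)) \<longlonglongrightarrow> 0"
        using \<open>0 \<le> u\<close> by (rule AE_null_imp_truncations_null[OF assms(2)])
      then have "\<epsilon> \<le> 0"
        using q by (intro LIMSEQ_le_const) auto
      with \<open>\<epsilon> > 0\<close> show False by simp
    qed
    then show "(\<lambda>n. norm (inf \<bar>x n - 0\<bar> u)) \<longlonglongrightarrow> 0" by simp
  qed
  ultimately show ?thesis
    unfolding in_measure_iff by blast
qed

end
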